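(* Let $\mathcal{S}_{1,2}$ be the set of odd positive integers and $\mathcal{S}_{2,2}$ the set of even positive integers. (1) The following $q$-series identities are true (for $|q|<1$): $$F_{\mathcal{S}_{1,2}}(q)=\sum_{n=1}^{\infty}(-1)^{n+1}q^{n^2},$$ $$F_{\mathcal{S}_{2,2}}(q)=1+\sum_{n=1}^{\infty}(-1)^{n}q^{n^2}-\sum_{m=-\infty}^{\infty}(-1)^m q^{\frac{m(3m-1)}{2}}.$$ (2) We have $$\lim_{q\to 1}F_{\mathcal{S}_{1,2}}(q)=\lim_{q\to 1}F_{\mathcal{S}_{2,2}}(q)=\frac12,$$ where the limits are understood as $q$ tends to $1$ from within the unit disk.
   Context: A partition is a finite non-increasing sequence of positive integers $\lambda=(\lambda_1,\dots,\lambda_{\ell(\lambda)})$; $\mathcal{P}$ is the set of all partitions, $\ell(\lambda)$ is the number of parts, $|\lambda|=\lambda_1+\cdots+\lambda_{\ell(\lambda)}$ is the size, and $\mathrm{sm}(\lambda)=\lambda_{\ell(\lambda)}$ is the smallest part (defined for nonempty $\lambda$). The partition-theoretic Möbius function is $\mu_{\mathcal{P}}(\lambda)=0$ if $\lambda$ has repeated parts and $\mu_{\mathcal{P}}(\lambda)=(-1)^{\ell(\lambda)}$ otherwise; put $\mu^*_{\mathcal{P}}(\lambda)=-\mu_{\mathcal{P}}(\lambda)$. For a set $\mathcal{S}$ of positive integers and $|q|<1$, define $$F_{\mathcal{S}}(q)=\sum_{\lambda\in\mathcal{P},\ \mathrm{sm}(\lambda)\in\mathcal{S}}\mu^*_{\mathcal{P}}(\lambda)q^{|\lambda|},$$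 the sum running over nonempty partitions whose smallest part lies in $\mathcal{S}$.
   Formalization: In (2), "q tends to 1 from within the unit disk" is taken as nontangential approach (in every Stolz region at 1), because the unrestricted limit in the disk fails: F is unbounded near roots of unity accumulating at 1. *)

theory Defs
  imports "HOL-Analysis.Analysis"
begin

definition partitions :: "nat list set" where
  "partitions = {xs. sorted_wrt (\<ge>) xs \<and> (\<forall>x\<in>set xs. 0 < x)}"

definition moebius_partition :: "nat list \<Rightarrow> int" where
  "moebius_partition xs = (if distinct xs then (-1) ^ length xs else 0)"

definition moebius_partition_star :: "nat list \<Rightarrow> int" where
  "moebius_partition_star xs = - moebius_partition xs"

text \<open>Partitions are listed in non-increasing order, so the smallest part is the last entry;
  the value at the empty partition is irrelevant.\<close>

definition sm :: "nat list \<Rightarrow> nat" where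
  "sm xs = last xs"

text \<open>For \<open>norm q < 1\<close> the unordered sum converges absolutely, being dominated by the
  expansion of \<open>\<Prod>n\<ge>1. (1 + norm q ^ n)\<close>.\<close>

definition F :: "nat set \<Rightarrow> complex \<Rightarrow> complex" where
  "F S q = (\<Sum>\<^sub>\<infinity>xs\<in>{xs \<in> partitions. xs \<noteq> [] \<and> sm xs \<in> S}.
     of_int (moebius_partition_star xs) * q ^ sum_list xs)"

definition S12 :: "nat set" where "S12 = {n. 0 < n \<and> odd n}"

definition S22 :: "nat set" where "S22 = {n. 0 < n \<and> even n}"

text \<open>Approach to \<open>1\<close> from within the unit disk is nontangential, i.e. inside a Stolz region of
  arbitrary aperture \<open>M\<close>; for \<open>M \<ge> 1\<close> this region contains the radius \<open>{0..<1}\<close>. A limit along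
  the whole open disk is not meaningful here: \<open>\<Sum>n\<ge>1. (-1)^n q^(n^2)\<close> is unbounded on radii to
  the roots of unity \<open>exp (2 \<pi> \<i> / b)\<close> with \<open>b mod 4 = 2\<close>, and these accumulate at \<open>1\<close>.\<close>

definition stolz_region :: "real \<Rightarrow> complex set" where
  "stolz_region M = {q. norm q < 1 \<and> norm (1 - q) \<le> M * (1 - norm q)}"

end

theory Submission
  imports Defs
begin

text \<open>Write \<open>(a; q)_n\<close> for \<open>\<Prod>k<n. 1 - a * q ^ k\<close>. Only partitions into distinct parts contribute to \<open>F S q\<close>.
Removing a largest part \<open>n + 1\<close> turns the partial sum over strict partitions with parts at most
\<open>n + 1\<close> into the recursion
\<open>x (n + 1) = (1 - q ^ (n + 1)) * x n + [n + 1 \<in> S] * q ^ (n + 1)\<close> (lemma \<open>F_upto_Suc\<close>). For all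
positive integers its solution is \<open>1 - (q; q)_n\<close>. For the odd integers it is \<open>(1 - k n) / 2\<close> with
\<open>k n = (q; q)_n * (\<Sum>j\<le>n. (-q) ^ j / (q; q)_j)\<close>, because the indicator function of the odd integers
is \<open>(1 - (-1) ^ j) / 2\<close>. By Euler's expansion of \<open>1 / (z; q)_\<infinity>\<close> at \<open>z = -q\<close>, the sequence \<open>k\<close> has the same
limit as \<open>(q; q)_n / (-q; q)_n\<close>. So the identities reduce to two classical expansions of infinite
products as theta series,

  \<open>(q; q)_\<infinity> = \<Sum>m\<in>\<int>. (-1) ^ m * q ^ (m * (3 * m - 1) / 2)\<close>  (Euler),
  \<open>(q; q)_\<infinity> / (-q; q)_\<infinity> = \<Sum>m\<in>\<int>. (-1) ^ m * q ^ (m ^ 2)\<close>  (Gauss).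

Both are proved by Shanks' method: a truncated theta series equals exactly a finite sum whose
leading term is the finite product and whose other terms carry a factor \<open>q ^ (n * s)\<close>
with \<open>s \<ge> 1\<close>. The exact identity follows by induction on \<open>n\<close>, the increment being a telescoping sum, and the
other terms vanish as \<open>n\<close> grows.

All series involved are combinations of the one-sided theta series
\<open>\<Sum>n. (-1) ^ n * q ^ (c * (n choose 2) + b * n)\<close>: the squares have \<open>(c, b) = (2, 1)\<close>, and the two
halves of the pentagonal numbers have \<open>(3, 1)\<close> and \<open>(3, 2)\<close>. Each of these tends to \<open>1 / 2\<close> in every
Stolz region (lemma \<open>partial_theta_tendsto_half\<close>): applying Euler's transformation of alternating series twice
gives \<open>1 / 2\<close> plus a quarter of the alternating sum of second differences, and these second differences
are dominated by a multiple of \<open>1 / n ^ 2\<close> uniformly in the region. The two limits of the theorem are then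
\<open>1 - 1 / 2\<close> and \<open>1 + 1 / 2 - 1 / 2 - 1 / 2\<close>.\<close>

section \<open>Finite \<open>q\<close>-products\<close>

text \<open>This is the \<open>q\<close>-Pochhammer symbol \<open>(a * q; q)_n\<close>; the values \<open>a = 1\<close> and \<open>a = -1\<close> give \<open>(q; q)_n\<close> and
\<open>(-q; q)_n\<close>.\<close>

definition qpoch :: "complex \<Rightarrow> complex \<Rightarrow> nat \<Rightarrow> complex" where
  "qpoch a q n = (\<Prod>i=1..n. 1 - a * q ^ i)"

lemma qpoch_0 [simp]: "qpoch a q 0 = 1"
  by (simp add: qpoch_def)

lemma qpoch_Suc: "qpoch a q (Suc n) = qpoch a q n * (1 - a * q ^ Suc n)"
  by (simp add: qpoch_def)

lemma geometric_upto_le: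
  fixes r :: real
  assumes "0 \<le> r" "r < 1"
  shows "(\<Sum>i=1..n. r ^ i) \<le> 1 / (1 - r)"
proof -
  have "(\<Sum>i=1..n. r ^ i) \<le> (\<Sum>i. r ^ i)"
    using assms by (intro sum_le_suminf) auto
  then show ?thesis
    using assms by (simp add: suminf_geometric)
qed

text \<open>Since \<open>1 / (1 - x) = 1 + x / (1 - x) \<le> exp (x / (1 - x))\<close>, the product is at most the exponential of a
geometric sum. The bound does not depend on \<open>n\<close>, which is what the limit arguments need; factors
\<open>1 \<plusminus> q ^ i\<close> and their inverses all satisfy the hypothesis.\<close>

lemma prod_upto_bounded:
  fixes g :: "nat \<Rightarrow> complex"
  assumes r: "0 \<le> r" "r < 1" and g: "\<And>i. 1 \<le> i \<Longrightarrow> norm (g i) \<le> 1 / (1 - r ^ i)"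
  shows "norm (\<Prod>i=1..n. g i) \<le> exp (1 / (1 - r)^2)"
proof -
  have "norm (g i) \<le> exp (r ^ i / (1 - r))" if "i \<in> {1..n}" for i
  proof -
    have ri: "r ^ i \<le> r" "0 \<le> r ^ i"
      using that r power_decreasing[of 1 i r] by auto
    have "norm (g i) \<le> 1 / (1 - r ^ i)" using g that by auto
    also have "\<dots> = 1 + r ^ i / (1 - r ^ i)" using ri r by (simp add: field_simps)
    also have "\<dots> \<le> 1 + r ^ i / (1 - r)"
      using ri r by (intro add_left_mono divide_left_mono) auto
    also have "\<dots> \<le> exp (r ^ i / (1 - r))" by (rule exp_ge_add_one_self)
    finally show ?thesis .
  qed
  then have "norm (\<Prod>i=1..n. g i) \<le> (\<Prod>i=1..n. exp (r ^ i / (1 - r)))"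
    unfolding prod_norm[symmetric] by (intro prod_mono) auto
  also have "\<dots> = exp ((\<Sum>i=1..n. r ^ i) / (1 - r))"
    by (simp add: exp_sum sum_divide_distrib)
  also have "\<dots> \<le> exp ((1 / (1 - r)) / (1 - r))"
    unfolding exp_le_cancel_iff
    using geometric_upto_le[OF r, of n] r by (intro divide_right_mono) auto
  also have "(1 / (1 - r)) / (1 - r) = 1 / (1 - r)^2" by (simp add: power2_eq_square)
  finally show ?thesis .
qed

lemma qpoch_bounds:
  assumes q: "norm q < 1" and a: "norm a \<le> 1"
  shows qpoch_bounded: "norm (qpoch a q n) \<le> exp (1 / (1 - norm q)^2)"
    and inverse_qpoch_bounded: "norm (inverse (qpoch a q n)) \<le> exp (1 / (1 - norm q)^2)"
    and qpoch_nonzero: "qpoch a q n \<noteq> 0"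
proof -
  have aq: "norm (a * q ^ i) \<le> norm q ^ i" and qi: "norm q ^ i < 1" if "1 \<le> i" for i
  proof -
    show "norm (a * q ^ i) \<le> norm q ^ i"
      using mult_right_mono[OF a, of "norm q ^ i"] by (simp add: norm_mult norm_power)
    show "norm q ^ i < 1" using q that by (simp add: power_less_one_iff)
  qed
  have up: "norm (1 - a * q ^ i) \<le> 1 / (1 - norm q ^ i)" if "1 \<le> i" for i
  proof -
    have "norm (1 - a * q ^ i) \<le> 1 + norm q ^ i"
      using norm_triangle_ineq4[of 1 "a * q ^ i"] aq[OF that] by simp
    also have "\<dots> \<le> 1 / (1 - norm q ^ i)"
      using qi[OF that] by (simp add: field_simps)
    finally show ?thesis .
  qed
  have lo: "1 - norm q ^ i \<le> norm (1 - a * q ^ i)" if "1 \<le> i" for i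
    using norm_triangle_ineq2[of 1 "a * q ^ i"] aq[OF that] by simp
  show "qpoch a q n \<noteq> 0"
    using lo qi by (fastforce simp: qpoch_def)
  show "norm (qpoch a q n) \<le> exp (1 / (1 - norm q)^2)"
    unfolding qpoch_def by (intro prod_upto_bounded up) (use q in auto)
  have "norm (inverse (1 - a * q ^ i)) \<le> 1 / (1 - norm q ^ i)" if "1 \<le> i" for i
    using lo[OF that] qi[OF that] by (simp add: norm_inverse divide_inverse le_imp_inverse_le)
  then show "norm (inverse (qpoch a q n)) \<le> exp (1 / (1 - norm q)^2)"
    unfolding qpoch_def prod_inversef[symmetric]
    by (intro prod_upto_bounded) (use q in auto)
qed

text \<open>The error terms in Shanks' identities have this form. There are \<open>n\<close> of them, each at most
\<open>B * norm q ^ n\<close>.\<close>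

lemma tail_terms_vanish:
  fixes q :: complex and w :: "nat \<Rightarrow> nat \<Rightarrow> complex"
  assumes q: "norm q < 1" and w: "\<And>n s. norm (w n s) \<le> B"
  shows "(\<lambda>n. \<Sum>s=1..n. w n s * q ^ (n * s)) \<longlonglongrightarrow> 0"
proof (rule Lim_null_comparison)
  show "(\<lambda>n. B * (real n * norm q ^ n)) \<longlonglongrightarrow> 0"
    using tendsto_mult_right_zero[OF powser_times_n_limit_0[of "norm q"], of B] q by simp
  have "norm (\<Sum>s=1..n. w n s * q ^ (n * s)) \<le> B * (real n * norm q ^ n)" for n
  proof -
    have "norm (w n s * q ^ (n * s)) \<le> B * norm q ^ n" if "s \<in> {1..n}" for s
    proof -
      have "n * 1 \<le> n * s" using that by (intro mult_left_mono) auto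
      then have "norm q ^ (n * s) \<le> norm q ^ n"
        using q by (intro power_decreasing) auto
      then show ?thesis
        unfolding norm_mult norm_power by (intro mult_mono w) (use order_trans[OF norm_ge_zero w] in auto)
    qed
    then have "norm (\<Sum>s=1..n. w n s * q ^ (n * s)) \<le> (\<Sum>s=1..n. B * norm q ^ n)"
      by (rule sum_norm_le)
    then show ?thesis by (simp add: mult.left_commute)
  qed
  then show "\<forall>\<^sub>F n in sequentially. norm (\<Sum>s=1..n. w n s * q ^ (n * s)) \<le> B * (real n * norm q ^ n)"
    by simp
qed

section \<open>One-sided theta series\<close>

text \<open>The exponent \<open>c * (n choose 2) + b * n\<close> vanishes at \<open>0\<close>, its first
difference is \<open>c * n + b\<close> and its second difference is the
constant \<open>c\<close>.\<close>

definition partial_theta :: "nat \<Rightarrow> nat \<Rightarrow> complex \<Rightarrow> complex" where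
  "partial_theta c b q = (\<Sum>n. (-1) ^ n * q ^ (c * (n choose 2) + b * n))"

lemma summable_partial_theta:
  fixes q :: complex
  assumes "norm q < 1" "1 \<le> b"
  shows "summable (\<lambda>n. norm ((-1) ^ n * q ^ (c * (n choose 2) + b * n)))"
proof (rule summable_comparison_test')
  show "summable (\<lambda>n. norm q ^ n)" using assms by (simp add: summable_geometric)
  show "norm (norm ((-1) ^ n * q ^ (c * (n choose 2) + b * n))) \<le> norm q ^ n" for n
  proof -
    have "n \<le> c * (n choose 2) + b * n"
      using assms(2) by (intro trans_le_add2) simp
    then show ?thesis
      using assms(1) by (simp add: norm_mult norm_power power_decreasing)
  qed
qed

lemma partial_theta_sums:
  assumes "norm q < 1" "1 \<le> b"
  shows "(\<lambda>n. (-1) ^ n * q ^ (c * (n choose 2) + b * n)) sums partial_theta c b q"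
  unfolding partial_theta_def
  using summable_norm_cancel[OF summable_partial_theta[OF assms]] by (rule summable_sums)

lemma partial_theta_has_sum:
  assumes "norm q < 1" "1 \<le> b"
  shows "((\<lambda>n. (-1) ^ n * q ^ (c * (n choose 2) + b * n)) has_sum partial_theta c b q) UNIV"
  by (intro norm_summable_imp_has_sum summable_partial_theta partial_theta_sums assms)

lemma partial_theta_has_sum_pos:
  assumes "norm q < 1" "1 \<le> b"
  shows "((\<lambda>n. (-1) ^ n * q ^ (c * (n choose 2) + b * n)) has_sum (partial_theta c b q - 1)) {1..}"
proof -
  have "UNIV - {0} = {1::nat..}" by auto
  moreover have "((\<lambda>n. (-1) ^ n * q ^ (c * (n choose 2) + b * n)) has_sum 1) {0::nat}"
    using has_sum_finite[of "{0::nat}" "\<lambda>n. (-1) ^ n * q ^ (c * (n choose 2) + b * n)"]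
    by (simp add: binomial_eq_0)
  ultimately show ?thesis
    using has_sum_Diff[OF partial_theta_has_sum[OF assms, of c], of "{0}" 1] by simp
qed

lemma choose_two_Suc: "Suc n choose 2 = (n choose 2) + n"
  by (simp add: numeral_2_eq_2)

lemma double_choose_two: "2 * (n choose 2) + n = n\<^sup>2"
  by (induction n) (simp_all add: choose_two_Suc power2_eq_square binomial_eq_0)

section \<open>Euler's pentagonal number theorem\<close>

text \<open>Shanks' finite form of the pentagonal number theorem. The left side is the sum of
\<open>(-1) ^ m * q ^ (m * (3 * m - 1) div 2)\<close> over \<open>\<bar>m\<bar> \<le> n\<close>; the index \<open>0\<close> occurs in both sums, hence the
correction by \<open>1\<close>. On the right, the term \<open>s = 0\<close> is \<open>(q; q)_n\<close>.\<close>

lemma shanks_pentagonal: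
  assumes q: "norm q < 1"
  shows "(\<Sum>s\<le>n. (-1) ^ s * q ^ (3 * (s choose 2) + s)) + (\<Sum>s\<le>n. (-1) ^ s * q ^ (3 * (s choose 2) + 2 * s)) - 1
       = (\<Sum>s\<le>n. (-1) ^ s * (qpoch 1 q n / qpoch 1 q s) * q ^ ((Suc s choose 2) + n * s))"
proof (induction n)
  case 0
  show ?case by (simp add: binomial_eq_0)
next
  case (Suc n)
  note nz = qpoch_nonzero[OF q, of 1, simplified]
  define P where "P = qpoch 1 q"
  \<comment> \<open>The increment from \<open>n\<close> to \<open>n + 1\<close> of the term with index \<open>s\<close> is \<open>v (Suc s) - v s\<close>; the factor
    \<open>(1 - q ^ (n + 1)) * q ^ s - 1\<close> splits as \<open>- (1 - q ^ s) - q ^ (n + 1 + s)\<close>.\<close>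
  define v where "v s = (-1) ^ s * (P n / P s) * (1 - q ^ s) * q ^ ((Suc s choose 2) + n * s)" for s
  have P: "P (Suc s) = P s * (1 - q ^ Suc s)" "P s \<noteq> 0" "q ^ Suc s \<noteq> 1" for s
    using nz[of s] nz[of "Suc s"] by (auto simp: P_def qpoch_Suc)
  let ?t = "\<lambda>n s. (-1) ^ s * (P n / P s) * q ^ ((Suc s choose 2) + n * s)"
  have step: "?t (Suc n) s - ?t n s = v (Suc s) - v s" for s
  proof -
    have v': "v (Suc s) = - ((-1) ^ s * (P n / P s) * q ^ ((Suc s choose 2) + n * s) * q ^ Suc n * q ^ s)"
    proof -
      have "1 - q ^ Suc s \<noteq> 0" using P(3)[of s] by auto
      then have "P n / P (Suc s) * (1 - q ^ Suc s) = P n / P s"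
        using P(2)[of s] by (simp add: P(1) divide_simps del: power_Suc)
      moreover have "q ^ ((Suc (Suc s) choose 2) + n * Suc s) = q ^ ((Suc s choose 2) + n * s) * q ^ Suc n * q ^ s"
        unfolding power_add[symmetric] by (simp add: choose_two_Suc[of "Suc s"] algebra_simps)
      moreover have "v (Suc s) = (-1) ^ Suc s * (P n / P (Suc s) * (1 - q ^ Suc s)) * q ^ ((Suc (Suc s) choose 2) + n * Suc s)"
        unfolding v_def by (simp only: mult.assoc)
      ultimately have "v (Suc s) = (-1) ^ Suc s * (P n / P s) * (q ^ ((Suc s choose 2) + n * s) * q ^ Suc n * q ^ s)"
        by (simp only:)
      then show ?thesis by (simp add: mult.assoc)
    qed
    have "?t (Suc n) s = (-1) ^ s * (P n / P s) * q ^ ((Suc s choose 2) + n * s) * ((1 - q ^ Suc n) * q ^ s)"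
      by (simp add: P(1) power_add algebra_simps)
    moreover have ring: "C * ((1 - a) * b) - C = - (C * a * b) - C * (1 - b)" for C a b :: complex
      by (simp add: algebra_simps)
    moreover have "v s = (-1) ^ s * (P n / P s) * q ^ ((Suc s choose 2) + n * s) * (1 - q ^ s)"
      unfolding v_def by (simp only: mult_ac)
    ultimately show ?thesis
      unfolding v' by (simp only: ring)
  qed
  have "(\<Sum>s\<le>Suc n. ?t (Suc n) s) - (\<Sum>s\<le>n. ?t n s)
      = ?t (Suc n) (Suc n) + (\<Sum>s\<le>n. v (Suc s) - v s)"
    by (simp only: step[symmetric] sum.atMost_Suc sum_subtractf) simp
  also have "(\<Sum>s\<le>n. v (Suc s) - v s) = v (Suc n) - v 0"
    by (simp add: atMost_atLeast0 sum_Suc_diff)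
  also have "v 0 = 0" by (simp add: v_def)
  also have "v (Suc n) = (-1) ^ Suc n * q ^ (3 * (Suc n choose 2) + Suc n)"
  proof -
    have "1 - q ^ Suc n \<noteq> 0" using P(3)[of n] by auto
    then have "v (Suc n) = (-1) ^ Suc n * q ^ ((Suc (Suc n) choose 2) + n * Suc n)"
      using P(2)[of n] by (simp add: v_def P(1) divide_simps del: power_Suc)
    also have "(Suc (Suc n) choose 2) + n * Suc n = 3 * (Suc n choose 2) + Suc n"
      using double_choose_two[of "Suc n"] by (simp add: choose_two_Suc[of "Suc n"] power2_eq_square algebra_simps)
    finally show ?thesis .
  qed
  also have "?t (Suc n) (Suc n) = (-1) ^ Suc n * q ^ (3 * (Suc n choose 2) + 2 * Suc n)"
  proof -
    have "(Suc (Suc n) choose 2) + Suc n * Suc n = 3 * (Suc n choose 2) + 2 * Suc n"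
      using double_choose_two[of "Suc n"] by (simp add: choose_two_Suc[of "Suc n"] power2_eq_square algebra_simps)
    then show ?thesis by (simp only: divide_self[OF P(2)] mult_1_right)
  qed
  finally show ?case
    using Suc.IH unfolding P_def by (simp add: algebra_simps del: power_Suc)
qed

lemma qpoch_tendsto_pentagonal:
  assumes q: "norm q < 1"
  shows "qpoch 1 q \<longlonglongrightarrow> partial_theta 3 1 q + partial_theta 3 2 q - 1"
proof -
  let ?w = "\<lambda>n s. (-1) ^ s * (qpoch 1 q n / qpoch 1 q s) * q ^ (Suc s choose 2)"
  define A where "A n = (\<Sum>s\<le>n. (-1) ^ s * q ^ (3 * (s choose 2) + 1 * s))
     + (\<Sum>s\<le>n. (-1) ^ s * q ^ (3 * (s choose 2) + 2 * s)) - 1" for n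
  have A: "A \<longlonglongrightarrow> partial_theta 3 1 q + partial_theta 3 2 q - 1"
    unfolding A_def using q
    by (intro tendsto_intros partial_theta_sums[unfolded sums_def_le]) auto
  have "(\<lambda>n. \<Sum>s=1..n. ?w n s * q ^ (n * s)) \<longlonglongrightarrow> 0"
  proof (rule tail_terms_vanish[OF q])
    fix n s
    let ?B = "exp (1 / (1 - norm q)^2)"
    have "norm (?w n s) = norm (qpoch 1 q n) * norm (inverse (qpoch 1 q s)) * norm q ^ (Suc s choose 2)"
      by (simp add: norm_mult norm_power norm_divide norm_inverse divide_inverse)
    also have "\<dots> \<le> ?B * ?B * 1"
      using q by (intro mult_mono qpoch_bounded inverse_qpoch_bounded power_le_one) auto
    finally show "norm (?w n s) \<le> ?B * ?B * 1" .
  qed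
  with A have "(\<lambda>n. A n - (\<Sum>s=1..n. ?w n s * q ^ (n * s))) \<longlonglongrightarrow> partial_theta 3 1 q + partial_theta 3 2 q - 1 - 0"
    by (rule tendsto_diff)
  moreover have "A n - (\<Sum>s=1..n. ?w n s * q ^ (n * s)) = qpoch 1 q n" for n
  proof -
    have "A n = (\<Sum>s\<le>n. ?w n s * q ^ (n * s))"
      unfolding A_def using shanks_pentagonal[OF q, of n] by (simp add: power_add mult.assoc)
    also have "\<dots> = qpoch 1 q n + (\<Sum>s=1..n. ?w n s * q ^ (n * s))"
      by (simp add: atMost_atLeast0 sum.atLeast_Suc_atMost binomial_eq_0)
    finally show ?thesis by simp
  qed
  ultimately show ?thesis by simp
qed

section \<open>Gauss' series over the squares\<close>

text \<open>The analogue of Shanks' identity for \<open>(q; q)_n / (-q; q)_n\<close>. Pairing consecutive squares on the left amounts to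
summing \<open>(-1) ^ m * q ^ (m ^ 2)\<close> over the range \<open>- n \<le> m < n\<close>. On the right, the term \<open>s = 0\<close> is \<open>(1 + q ^ n) * R n\<close>.\<close>

lemma shanks_gauss:
  assumes q: "norm q < 1"
  defines "R \<equiv> \<lambda>n. qpoch 1 q n / qpoch (-1) q n"
  shows "(\<Sum>s<n. (-1) ^ s * (q ^ s\<^sup>2 - q ^ (Suc s)\<^sup>2))
       = (1 + q ^ n) * (\<Sum>s<n. (-1) ^ s * (R n / R s) * q ^ (n * s))"
proof (induction n)
  case 0
  show ?case by simp
next
  case (Suc n)
  have nz: "qpoch 1 q s \<noteq> 0" "qpoch (-1) q s \<noteq> 0" for s
    using qpoch_nonzero[OF q] by simp_all
  have R: "R s \<noteq> 0" "1 + q ^ Suc s \<noteq> 0" "(1 + q ^ Suc s) * R (Suc s) = R s * (1 - q ^ Suc s)" for s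
  proof -
    show "R s \<noteq> 0" using nz by (simp add: R_def)
    show p: "1 + q ^ Suc s \<noteq> 0" using nz(2)[of "Suc s"] by (simp add: qpoch_Suc)
    show "(1 + q ^ Suc s) * R (Suc s) = R s * (1 - q ^ Suc s)"
      using p nz by (simp add: R_def qpoch_Suc divide_simps del: power_Suc)
  qed
  \<comment> \<open>Up to the factor \<open>R n * (-1) ^ s * q ^ (n * s) / R s\<close>, the increment is
    \<open>(1 - q ^ (n + 1)) * q ^ s - (1 + q ^ n) = - (1 - q ^ s) - q ^ n * (1 + q ^ (s + 1))\<close>, and the
    recursion for \<open>R\<close> turns the last term into the successor of the first.\<close>
  define v where "v s = (-1) ^ s * (R n / R s) * (1 - q ^ s) * q ^ (n * s)" for s
  let ?t = "\<lambda>n s. (-1) ^ s * (R n / R s) * q ^ (n * s)"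
  have expand: "(1 + q ^ Suc n) * ?t (Suc n) s = ?t n s * ((1 - q ^ Suc n) * q ^ s)" for s
  proof -
    have "(1 + q ^ Suc n) * ?t (Suc n) s = (-1) ^ s * (((1 + q ^ Suc n) * R (Suc n)) / R s) * q ^ (Suc n * s)"
      by (simp del: power_Suc)
    then show ?thesis
      unfolding R(3) by (simp add: power_add del: power_Suc)
  qed
  have step: "(1 + q ^ Suc n) * ?t (Suc n) s - (1 + q ^ n) * ?t n s = v (Suc s) - v s" for s
  proof -
    have "(1 - q ^ Suc s) * (R n / R (Suc s)) = (1 + q ^ Suc s) * (R n / R s)"
      using R(1)[of s] R(1)[of "Suc s"] R(3)[of s] by (simp add: divide_simps mult_ac del: power_Suc)
    moreover have "v (Suc s) = (-1) ^ Suc s * ((1 - q ^ Suc s) * (R n / R (Suc s))) * q ^ (n * Suc s)"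
      unfolding v_def by (simp only: mult_ac)
    ultimately have "v (Suc s) = (-1) ^ Suc s * ((1 + q ^ Suc s) * (R n / R s)) * q ^ (n * Suc s)"
      by (simp only:)
    then have v': "v (Suc s) = - (?t n s * (1 + q ^ Suc s) * q ^ n)"
      by (simp add: power_add mult_ac)
    have "v s = ?t n s * (1 - q ^ s)"
      unfolding v_def by (simp only: mult_ac)
    moreover have ring: "t * ((1 - A) * b) - (1 + N) * t = - (t * (1 + a) * N) - t * (1 - b)"
      if "A * b = a * N" for t A N a b :: complex
      using that by (simp add: algebra_simps)
    moreover have "q ^ Suc n * q ^ s = q ^ Suc s * q ^ n"
      by (simp add: mult_ac)
    ultimately show ?thesis
      unfolding expand v' by (simp only: ring)
  qed
  have "(1 + q ^ Suc n) * (\<Sum>s<Suc n. ?t (Suc n) s) - (1 + q ^ n) * (\<Sum>s<n. ?t n s)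
      = (1 + q ^ Suc n) * ?t (Suc n) n + (\<Sum>s<n. v (Suc s) - v s)"
    by (simp only: step[symmetric] sum.lessThan_Suc sum_subtractf sum_distrib_left distrib_left add_diff_eq)
      (simp only: diff_add_eq add.commute)
  also have "(\<Sum>s<n. v (Suc s) - v s) = v n - v 0"
    by (rule sum_lessThan_telescope)
  also have "v 0 = 0" by (simp add: v_def)
  also have "v n = (-1) ^ n * (1 - q ^ n) * q ^ n\<^sup>2"
    using R(1) by (simp add: v_def power2_eq_square)
  also have "(1 + q ^ Suc n) * ?t (Suc n) n = (-1) ^ n * (1 - q ^ Suc n) * q ^ n * q ^ n\<^sup>2"
    unfolding expand using R(1)[of n] by (simp add: power2_eq_square del: power_Suc)
  also have "\<dots> + ((-1) ^ n * (1 - q ^ n) * q ^ n\<^sup>2 - 0) = (-1) ^ n * (q ^ n\<^sup>2 - q ^ (Suc n)\<^sup>2)"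
  proof -
    have "q ^ (Suc n)\<^sup>2 = q ^ Suc n * q ^ n * q ^ n\<^sup>2"
      unfolding power_add[symmetric] by (simp add: power2_eq_square algebra_simps)
    then show ?thesis by (simp only:) (simp only: algebra_simps, simp)
  qed
  finally show ?case
    using Suc.IH by (simp add: algebra_simps del: power_Suc)
qed

lemma qpoch_quotient_tendsto_gauss:
  assumes q: "norm q < 1"
  shows "(\<lambda>n. qpoch 1 q n / qpoch (-1) q n) \<longlonglongrightarrow> 2 * partial_theta 2 1 q - 1"
proof -
  define R where "R n = qpoch 1 q n / qpoch (-1) q n" for n
  let ?B = "exp (1 / (1 - norm q)^2)"
  have RB: "norm (R n) \<le> ?B * ?B" and RB': "norm (inverse (R n)) \<le> ?B * ?B" for n
  proof -
    have "norm (R n) = norm (qpoch 1 q n) * norm (inverse (qpoch (-1) q n))"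
      by (simp add: R_def norm_divide norm_mult norm_inverse divide_inverse)
    also have "\<dots> \<le> ?B * ?B"
      using q by (intro mult_mono qpoch_bounded inverse_qpoch_bounded) auto
    finally show "norm (R n) \<le> ?B * ?B" .
    have "norm (inverse (R n)) = norm (qpoch (-1) q n) * norm (inverse (qpoch 1 q n))"
      by (simp add: R_def norm_divide norm_mult norm_inverse divide_inverse)
    also have "\<dots> \<le> ?B * ?B"
      using q by (intro mult_mono qpoch_bounded inverse_qpoch_bounded) auto
    finally show "norm (inverse (R n)) \<le> ?B * ?B" .
  qed
  define S where "S n = (\<Sum>s<n. (-1) ^ s * (q ^ s\<^sup>2 - q ^ (Suc s)\<^sup>2))" for n
  have "(\<lambda>s. (-1) ^ s * q ^ s\<^sup>2) sums partial_theta 2 1 q"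
    using partial_theta_sums[OF q, of 1 2] by (simp add: double_choose_two)
  moreover from this have "(\<lambda>s. (-1) ^ Suc s * q ^ (Suc s)\<^sup>2) sums (partial_theta 2 1 q - 1)"
    by (subst sums_Suc_iff) simp
  ultimately have "(\<lambda>s. (-1) ^ s * q ^ s\<^sup>2 + (-1) ^ Suc s * q ^ (Suc s)\<^sup>2)
      sums (partial_theta 2 1 q + (partial_theta 2 1 q - 1))"
    by (rule sums_add)
  then have S: "S \<longlonglongrightarrow> 2 * partial_theta 2 1 q - 1"
    unfolding S_def sums_def by (simp add: algebra_simps)
  \<comment> \<open>Cutting off at \<open>s = n\<close> makes the sum over \<open>s < n\<close> one over \<open>1..n\<close>, apart from the leading term.\<close>
  define w where "w n s = (if s < n then (-1) ^ s * (R n / R s) else 0)" for n s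
  have w: "norm (w n s) \<le> (?B * ?B) * (?B * ?B)" for n s
  proof -
    have "norm (w n s) \<le> norm (R n) * norm (inverse (R s))"
      by (simp add: w_def norm_mult norm_power norm_divide norm_inverse divide_inverse)
    also have "\<dots> \<le> (?B * ?B) * (?B * ?B)"
      by (intro mult_mono RB RB') auto
    finally show ?thesis .
  qed
  have qn: "(\<lambda>n. q ^ n) \<longlonglongrightarrow> 0"
    using q by (rule LIMSEQ_power_zero)
  have "(\<lambda>n. (1 + q ^ n) * (\<Sum>s=1..n. w n s * q ^ (n * s))) \<longlonglongrightarrow> (1 + 0) * 0"
    by (intro tendsto_intros qn tail_terms_vanish[OF q, OF w])
  moreover have "(\<lambda>n. q ^ n * R n) \<longlonglongrightarrow> 0"
  proof (rule Lim_null_comparison)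
    show "(\<lambda>n. norm (q ^ n) * (?B * ?B)) \<longlonglongrightarrow> 0"
      using tendsto_mult_left_zero[OF tendsto_norm_zero[OF qn]] .
    show "\<forall>\<^sub>F n in sequentially. norm (q ^ n * R n) \<le> norm (q ^ n) * (?B * ?B)"
      unfolding norm_mult by (intro always_eventually allI mult_left_mono RB) auto
  qed
  ultimately have "(\<lambda>n. S n - (1 + q ^ n) * (\<Sum>s=1..n. w n s * q ^ (n * s)) - q ^ n * R n)
      \<longlonglongrightarrow> 2 * partial_theta 2 1 q - 1 - (1 + 0) * 0 - 0"
    by (intro tendsto_diff S)
  moreover have "\<forall>\<^sub>F n in sequentially.
      S n - (1 + q ^ n) * (\<Sum>s=1..n. w n s * q ^ (n * s)) - q ^ n * R n = R n"
    using eventually_gt_at_top[of 0]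
  proof eventually_elim
    case (elim n)
    have "S n = (1 + q ^ n) * (\<Sum>s<n. w n s * q ^ (n * s))"
      unfolding S_def shanks_gauss[OF q] by (simp add: w_def R_def)
    also have "(\<Sum>s<n. w n s * q ^ (n * s)) = (\<Sum>s\<in>insert 0 {1..n}. w n s * q ^ (n * s))"
      by (rule sum.mono_neutral_left) (auto simp: w_def)
    also have "\<dots> = R n + (\<Sum>s=1..n. w n s * q ^ (n * s))"
      using elim by (simp add: w_def R_def)
    finally show ?case by (simp add: algebra_simps)
  qed
  ultimately show ?thesis
    unfolding R_def[symmetric] by (simp add: tendsto_cong)
qed

section \<open>Euler's expansion of a reciprocal product\<close>

text \<open>Euler's series \<open>\<Sum>n. z ^ n / (q; q)_n\<close>, which expands \<open>1 / (z; q)_\<infinity>\<close>.\<close>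

definition euler_series :: "complex \<Rightarrow> complex \<Rightarrow> complex" where
  "euler_series q z = (\<Sum>n. inverse (qpoch 1 q n) * z ^ n)"

lemma summable_euler_series:
  assumes q: "norm q < 1" and z: "norm z < 1"
  shows "summable (\<lambda>n. inverse (qpoch 1 q n) * z ^ n)"
proof (rule summable_comparison_test')
  show "summable (\<lambda>n. exp (1 / (1 - norm q)^2) * norm z ^ n)"
    using z by (intro summable_mult summable_geometric) simp
  show "norm (inverse (qpoch 1 q n) * z ^ n) \<le> exp (1 / (1 - norm q)^2) * norm z ^ n" for n
    unfolding norm_mult norm_power by (intro mult_right_mono inverse_qpoch_bounded q) auto
qed

text \<open>The factor \<open>1 - q ^ n\<close> in the difference of the two series cancels the last factor of \<open>(q; q)_n\<close>, so the
difference is \<open>z\<close> times the original series.\<close>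

lemma euler_series_shift:
  assumes q: "norm q < 1" and z: "norm z < 1"
  shows "euler_series q (q * z) = (1 - z) * euler_series q z"
proof -
  let ?c = "\<lambda>n. inverse (qpoch 1 q n)"
  have "norm (q * z) < 1"
    using mult_strict_mono[OF q z] by (simp add: norm_mult)
  then have "(\<lambda>n. ?c n * (q * z) ^ n) sums euler_series q (q * z)"
    unfolding euler_series_def by (intro summable_sums summable_euler_series q)
  moreover have E: "(\<lambda>n. ?c n * z ^ n) sums euler_series q z"
    unfolding euler_series_def by (intro summable_sums summable_euler_series q z)
  ultimately have "(\<lambda>n. ?c n * z ^ n - ?c n * (q * z) ^ n) sums (euler_series q z - euler_series q (q * z))"
    by (intro sums_diff)
  then have "(\<lambda>n. ?c (Suc n) * z ^ Suc n - ?c (Suc n) * (q * z) ^ Suc n)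
      sums (euler_series q z - euler_series q (q * z))"
    by (subst sums_Suc_iff) simp
  also have "(\<lambda>n. ?c (Suc n) * z ^ Suc n - ?c (Suc n) * (q * z) ^ Suc n) = (\<lambda>n. z * (?c n * z ^ n))"
  proof
    fix n
    have "1 - q ^ Suc n \<noteq> 0" "qpoch 1 q n \<noteq> 0"
      using qpoch_nonzero[OF q, of 1 "Suc n"] by (auto simp: qpoch_Suc)
    then have "?c (Suc n) * (1 - q ^ Suc n) = ?c n"
      by (simp add: qpoch_Suc divide_simps del: power_Suc)
    moreover have "?c (Suc n) * z ^ Suc n - ?c (Suc n) * (q * z) ^ Suc n = ?c (Suc n) * (1 - q ^ Suc n) * z ^ Suc n"
      by (simp add: power_mult_distrib algebra_simps del: power_Suc)
    ultimately show "?c (Suc n) * z ^ Suc n - ?c (Suc n) * (q * z) ^ Suc n = z * (?c n * z ^ n)"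
      by simp
  qed
  finally have "z * euler_series q z = euler_series q z - euler_series q (q * z)"
    using sums_mult[OF E, of z] sums_unique2 by blast
  then show ?thesis by (simp add: algebra_simps)
qed

lemma euler_series_neg_q:
  assumes q: "norm q < 1"
  shows "euler_series q (- (q ^ Suc n)) = qpoch (-1) q n * euler_series q (-q)"
proof (induction n)
  case (Suc n)
  have "norm (- (q ^ Suc n)) < 1"
    using q by (simp add: norm_power power_less_one_iff del: power_Suc)
  from euler_series_shift[OF q this] Suc show ?case
    by (simp add: qpoch_Suc mult_ac)
qed simp

text \<open>The shift relation, iterated from \<open>z = -q\<close>, moves the argument of Euler's series to \<open>0\<close>, where
the series is continuous with value \<open>1\<close>.\<close>

lemma inverse_qpoch_tendsto_euler:
  assumes q: "norm q < 1"
  shows "(\<lambda>n. inverse (qpoch (-1) q n)) \<longlonglongrightarrow> euler_series q (-q)"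
proof -
  have "isCont (euler_series q) 0"
    unfolding euler_series_def
    by (rule isCont_powser[of _ "1/2"]) (auto intro: summable_euler_series q)
  moreover have "(\<lambda>n. - (q ^ Suc n)) \<longlonglongrightarrow> 0"
    using tendsto_minus[OF LIMSEQ_Suc[OF LIMSEQ_power_zero[OF q]]] by simp
  ultimately have "(\<lambda>n. euler_series q (- (q ^ Suc n))) \<longlonglongrightarrow> euler_series q 0"
    by (rule isCont_tendsto_compose)
  moreover have "euler_series q 0 = 1"
    by (simp add: euler_series_def powser_zero)
  ultimately have lim: "(\<lambda>n. qpoch (-1) q n * euler_series q (-q)) \<longlonglongrightarrow> 1"
    unfolding euler_series_neg_q[OF q] by simp
  have nz: "euler_series q (-q) \<noteq> 0"
    using lim by (auto simp: tendsto_const_iff)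
  have "(\<lambda>n. euler_series q (-q) / (qpoch (-1) q n * euler_series q (-q))) \<longlonglongrightarrow> euler_series q (-q) / 1"
    by (intro tendsto_intros lim) simp
  then show ?thesis using nz by (simp add: inverse_eq_divide)
qed

text \<open>The sequence \<open>k\<close> of the introduction: twice the odd partial sum of \<open>F\<close>, subtracted from \<open>1\<close>.\<close>

definition alternating_qpoch_sum :: "complex \<Rightarrow> nat \<Rightarrow> complex" where
  "alternating_qpoch_sum q n = qpoch 1 q n * (\<Sum>k\<le>n. inverse (qpoch 1 q k) * (-q) ^ k)"

lemma alternating_qpoch_sum_0 [simp]: "alternating_qpoch_sum q 0 = 1"
  by (simp add: alternating_qpoch_sum_def)

lemma alternating_qpoch_sum_Suc:
  assumes "norm q < 1"
  shows "alternating_qpoch_sum q (Suc n) = (1 - q ^ Suc n) * alternating_qpoch_sum q n + (-q) ^ Suc n"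
  using qpoch_nonzero[OF assms, of 1 "Suc n"]
  by (simp add: alternating_qpoch_sum_def qpoch_Suc field_simps)

text \<open>Both this sequence and \<open>(q; q)_n / (-q; q)_n\<close> tend to \<open>(q; q)_\<infinity>\<close> times Euler's series at \<open>-q\<close>; Gauss'
expansion gives the value of the common limit.\<close>

lemma alternating_qpoch_sum_tendsto:
  assumes q: "norm q < 1"
  shows "alternating_qpoch_sum q \<longlonglongrightarrow> 2 * partial_theta 2 1 q - 1"
proof -
  let ?E = "euler_series q (-q)" and ?P = "partial_theta 3 1 q + partial_theta 3 2 q - 1"
  have "(\<lambda>n. \<Sum>k\<le>n. inverse (qpoch 1 q k) * (-q) ^ k) \<longlonglongrightarrow> ?E"
    using summable_sums[OF summable_euler_series[OF q, of "-q"]] q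
    by (simp add: sums_def_le euler_series_def)
  then have "alternating_qpoch_sum q \<longlonglongrightarrow> ?P * ?E"
    unfolding alternating_qpoch_sum_def by (intro tendsto_mult qpoch_tendsto_pentagonal q)
  moreover have "(\<lambda>n. qpoch 1 q n / qpoch (-1) q n) \<longlonglongrightarrow> ?P * ?E"
    unfolding divide_inverse
    by (intro tendsto_mult qpoch_tendsto_pentagonal inverse_qpoch_tendsto_euler q)
  ultimately show ?thesis
    using LIMSEQ_unique[OF qpoch_quotient_tendsto_gauss[OF q]] by metis
qed

section \<open>Nontangential limits of theta series at \<open>1\<close>\<close>

text \<open>Euler's transformation of an alternating series, applied twice and multiplied by \<open>4\<close>. It isolates the
contribution \<open>(3 - q ^ b) / 4\<close> of the first terms, which tends to \<open>1 / 2\<close>.\<close>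

lemma four_partial_theta:
  fixes q :: complex and b c :: nat
  assumes "norm q < 1" "1 \<le> b"
  defines "a \<equiv> \<lambda>n. q ^ (c * (n choose 2) + b * n)"
  shows "4 * partial_theta c b q = 3 - q ^ b + (\<Sum>n. (-1) ^ n * (a n - 2 * a (Suc n) + a (Suc (Suc n))))"
proof -
  let ?T = "partial_theta c b q"
  have a01: "a 0 = 1" "a (Suc 0) = q ^ b"
    by (simp_all add: a_def binomial_eq_0)
  have s0: "(\<lambda>n. (-1) ^ n * a n) sums ?T"
    unfolding a_def using assms by (intro partial_theta_sums) auto
  then have s1: "(\<lambda>n. (-1) ^ Suc n * a (Suc n)) sums (?T - 1)"
    by (subst sums_Suc_iff) (simp add: a01)
  then have s2: "(\<lambda>n. (-1) ^ Suc (Suc n) * a (Suc (Suc n))) sums (?T - 1 + q ^ b)"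
    by (subst sums_Suc_iff) (simp add: a01)
  have "(\<lambda>n. (-1) ^ n * a n + 2 * ((-1) ^ Suc n * a (Suc n)) + (-1) ^ Suc (Suc n) * a (Suc (Suc n)))
      sums (?T + 2 * (?T - 1) + (?T - 1 + q ^ b))"
    by (intro sums_add sums_mult s0 s1 s2)
  then have "(\<lambda>n. (-1) ^ n * (a n - 2 * a (Suc n) + a (Suc (Suc n)))) sums (4 * ?T - 3 + q ^ b)"
    by (simp add: algebra_simps)
  then show ?thesis by (simp add: sums_iff)
qed

text \<open>\<open>j * r ^ j\<close> is at most the geometric sum of the powers below \<open>j\<close>, which \<open>1 - r\<close> telescopes to \<open>1 - r ^ j\<close>.\<close>

lemma one_minus_mult_power_le:
  fixes r :: real
  assumes "0 \<le> r" "r \<le> 1"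
  shows "real j * ((1 - r) * r ^ j) \<le> 1"
proof -
  have "real j * r ^ j = (\<Sum>i<j. r ^ j)" by simp
  also have "\<dots> \<le> (\<Sum>i<j. r ^ i)"
    using assms by (intro sum_mono power_decreasing) auto
  finally have "(1 - r) * (real j * r ^ j) \<le> (1 - r) * (\<Sum>i<j. r ^ i)"
    using assms by (intro mult_left_mono) auto
  also have "\<dots> = 1 - r ^ j" by (simp add: one_diff_power_eq)
  also have "\<dots> \<le> 1" using assms by simp
  finally show ?thesis by (simp add: mult_ac)
qed

text \<open>The quadratic growth of the exponent trades each factor \<open>1 - r\<close> for a factor \<open>1 / (n + 1) ^ 2\<close>. The
constant comes from \<open>(n + 1) ^ 2 \<le> 9 * (n choose 2)\<close> for \<open>n \<ge> 2\<close>, with equality at \<open>n = 2\<close>.\<close>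

lemma square_mult_power_choose_two_le:
  fixes r :: real
  assumes r: "0 \<le> r" "r \<le> 1"
  shows "(real (Suc n))\<^sup>2 * ((1 - r) * r ^ (n choose 2)) \<le> 9"
proof (cases "n < 2")
  case True
  then have "n = 0 \<or> n = 1" by auto
  then have "(real (Suc n))\<^sup>2 \<le> 2\<^sup>2" by auto
  then have "(real (Suc n))\<^sup>2 * ((1 - r) * r ^ (n choose 2)) \<le> 2\<^sup>2 * (1 * 1)"
    using r by (intro mult_mono power_le_one) auto
  then show ?thesis by simp
next
  case False
  then obtain m where m: "n = Suc (Suc m)" by (metis add_2_eq_Suc le_add_diff_inverse not_less)
  have "2 * (Suc n)\<^sup>2 \<le> 9 * (2 * (n choose 2))"
    using double_choose_two[of n] by (simp add: m power2_eq_square)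
  then have "(Suc n)\<^sup>2 \<le> 9 * (n choose 2)" by simp
  then have "(real (Suc n))\<^sup>2 \<le> 9 * real (n choose 2)"
    by (metis of_nat_le_iff of_nat_mult of_nat_numeral of_nat_power)
  then have "(real (Suc n))\<^sup>2 * ((1 - r) * r ^ (n choose 2)) \<le> 9 * real (n choose 2) * ((1 - r) * r ^ (n choose 2))"
    using r by (intro mult_right_mono) auto
  also have "\<dots> \<le> 9 * 1"
    unfolding mult.assoc using one_minus_mult_power_le[OF r] by (intro mult_left_mono) auto
  finally show ?thesis by simp
qed

text \<open>With \<open>d = c * n + b\<close>, the second difference of the powers is \<open>q\<close> to the exponent at \<open>n\<close>, times
\<open>(1 - q ^ d) ^ 2 - q ^ (2 * d) * (1 - q ^ c)\<close>. In a Stolz region \<open>norm (1 - q ^ j) \<le> j * M * (1 - norm q)\<close>,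
so the first summand is of order \<open>n ^ 2 * (1 - norm q) ^ 2\<close> and the second of order \<open>1 - norm q\<close>. By the preceding
lemma the power of \<open>norm q\<close> compensates both down to order \<open>1 / n ^ 2\<close>; the first needs the estimate squared,
hence a factor \<open>norm q ^ (2 * (n choose 2))\<close>, which \<open>c \<ge> 2\<close> provides.\<close>

lemma second_difference_bound:
  fixes q :: complex and b c :: nat
  assumes q: "q \<in> stolz_region M" and M: "0 \<le> M" and c: "2 \<le> c"
  defines "a \<equiv> \<lambda>n. q ^ (c * (n choose 2) + b * n)"
  shows "norm ((-1) ^ n * (a n - 2 * a (Suc n) + a (Suc (Suc n))))
       \<le> (81 * (real (c + b) * M)\<^sup>2 + 9 * real c * M) * inverse ((real (Suc n))\<^sup>2)"
proof -
  define r where "r = norm q"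
  define k where "k = n choose 2"
  define d where "d = c * n + b"
  have r: "0 \<le> r" "r < 1" and M1: "norm (1 - q) \<le> M * (1 - r)"
    using q by (auto simp: stolz_region_def r_def)
  have power_diff: "norm (1 - q ^ j) \<le> real j * (M * (1 - r))" for j
  proof -
    have "norm (1 - q ^ j) = norm (1 - q) * norm (\<Sum>i<j. q ^ i)"
      by (simp add: one_diff_power_eq norm_mult)
    also have "\<dots> \<le> (M * (1 - r)) * (\<Sum>i<j. 1)"
      using r M M1 by (intro mult_mono sum_norm_le) (auto simp: norm_power r_def power_le_one)
    finally show ?thesis by (simp add: mult_ac)
  qed
  have a1: "a (Suc n) = a n * q ^ d"
    unfolding a_def power_add[symmetric] d_def by (simp add: choose_two_Suc algebra_simps mult_2 mult_2_right)
  have a2: "a (Suc (Suc n)) = a n * (q ^ (2 * d) * q ^ c)"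
    unfolding a_def power_add[symmetric] d_def by (simp add: choose_two_Suc algebra_simps mult_2 mult_2_right)
  have "a n - 2 * a (Suc n) + a (Suc (Suc n)) = a n * ((1 - q ^ d)\<^sup>2 - q ^ (2 * d) * (1 - q ^ c))"
    unfolding a1 a2 power_even_eq by (simp add: power2_eq_square algebra_simps)
  then have "norm ((-1) ^ n * (a n - 2 * a (Suc n) + a (Suc (Suc n))))
      = norm (a n) * norm ((1 - q ^ d)\<^sup>2 - q ^ (2 * d) * (1 - q ^ c))"
    by (simp add: norm_mult norm_power)
  also have "\<dots> \<le> r ^ (2 * k) * ((real (c + b) * M * (real (Suc n) * (1 - r)))\<^sup>2 + real c * (M * (1 - r)))"
  proof (intro mult_mono)
    have "2 * k \<le> c * (n choose 2) + b * n"
      using c unfolding k_def by (intro trans_le_add1 mult_right_mono) auto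
    then show "norm (a n) \<le> r ^ (2 * k)"
      using r unfolding a_def norm_power r_def by (intro power_decreasing) auto
    have "norm ((1 - q ^ d)\<^sup>2 - q ^ (2 * d) * (1 - q ^ c)) \<le> (norm (1 - q ^ d))\<^sup>2 + r ^ (2 * d) * norm (1 - q ^ c)"
      by (rule order.trans[OF norm_triangle_ineq4]) (simp add: norm_mult norm_power r_def)
    also have "\<dots> \<le> (real (c + b) * M * (real (Suc n) * (1 - r)))\<^sup>2 + 1 * (real c * (M * (1 - r)))"
    proof (intro add_mono power_mono mult_mono power_diff)
      have "d \<le> (c + b) * Suc n" by (simp add: d_def algebra_simps)
      then have "real d \<le> real (c + b) * real (Suc n)"
        by (metis of_nat_le_iff of_nat_mult)
      then have "real d * (M * (1 - r)) \<le> real (c + b) * real (Suc n) * (M * (1 - r))"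
        using M r by (intro mult_right_mono) auto
      with power_diff[of d] show "norm (1 - q ^ d) \<le> real (c + b) * M * (real (Suc n) * (1 - r))"
        by (simp only: mult_ac)
    qed (use r M in \<open>auto simp: power_le_one\<close>)
    finally show "norm ((1 - q ^ d)\<^sup>2 - q ^ (2 * d) * (1 - q ^ c))
        \<le> (real (c + b) * M * (real (Suc n) * (1 - r)))\<^sup>2 + real c * (M * (1 - r))"
      by simp
  qed (use r M in auto)
  also have "\<dots> = ((real (c + b) * M)\<^sup>2 * ((real (Suc n))\<^sup>2 * ((1 - r) * r ^ k))\<^sup>2
        + real c * M * r ^ k * ((real (Suc n))\<^sup>2 * ((1 - r) * r ^ k))) * inverse ((real (Suc n))\<^sup>2)"
  proof -
    have "x * x * ((A * (N * d))\<^sup>2 + C * (M * d))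
        = (A\<^sup>2 * (N\<^sup>2 * (d * x))\<^sup>2 + C * M * x * (N\<^sup>2 * (d * x))) * I"
      if "N\<^sup>2 * I = 1" for x A N I d C M :: real
      using that by algebra
    from this[of "real (Suc n)" "inverse ((real (Suc n))\<^sup>2)" "r ^ k" "real (c + b) * M" "1 - r" "real c" M]
    show ?thesis by (simp add: mult_2 power_add)
  qed
  also have "\<dots> \<le> ((real (c + b) * M)\<^sup>2 * 9\<^sup>2 + real c * M * 1 * 9) * inverse ((real (Suc n))\<^sup>2)"
    using square_mult_power_choose_two_le[of r n] r M
    by (intro mult_right_mono add_mono mult_mono power_mono) (auto simp: k_def power_le_one)
  finally show ?thesis by (simp add: mult_ac)
qed

text \<open>Each second difference tends to \<open>0\<close> as \<open>q\<close> tends to \<open>1\<close>, and by the uniform bound Tannery's theorem lets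
the limit pass through the sum.\<close>

lemma partial_theta_tendsto_half:
  assumes b: "1 \<le> b" and c: "2 \<le> c"
  shows "(partial_theta c b \<longlongrightarrow> 1 / 2) (at 1 within stolz_region M)"
proof (cases "at 1 within stolz_region M = bot")
  case True
  then show ?thesis by simp
next
  case nontrivial: False
  let ?F = "at 1 within stolz_region M"
  have "stolz_region M \<noteq> {}" using nontrivial by auto
  then obtain q :: complex where "norm q < 1" "norm (1 - q) \<le> M * (1 - norm q)"
    by (auto simp: stolz_region_def)
  then have "0 \<le> M * (1 - norm q)"
    using norm_ge_zero order_trans by blast
  with \<open>norm q < 1\<close> have M: "0 \<le> M"
    by (simp add: zero_le_mult_iff)
  define a where "a n q = q ^ (c * (n choose 2) + b * n)" for n and q :: complex
  define D where "D n q = (-1) ^ n * (a n q - 2 * a (Suc n) q + a (Suc (Suc n)) q)" for n q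
  define K where "K = 81 * (real (c + b) * M)\<^sup>2 + 9 * real c * M"
  have inside: "\<forall>\<^sub>F q in ?F. q \<in> stolz_region M"
    by (simp add: eventually_at_filter)
  have "((\<lambda>q. \<Sum>n. D n q) \<longlongrightarrow> (\<Sum>n. 0)) ?F"
  proof (rule tannerys_theorem[THEN conjunct2, THEN conjunct2])
    fix n
    have "(D n \<longlongrightarrow> (-1) ^ n * (1 ^ (c * (n choose 2) + b * n) - 2 * 1 ^ (c * (Suc n choose 2) + b * Suc n)
        + 1 ^ (c * (Suc (Suc n) choose 2) + b * Suc (Suc n)))) ?F"
      unfolding D_def a_def by (intro tendsto_intros)
    then show "(D n \<longlongrightarrow> 0) ?F" by simp
  next
    show "summable (\<lambda>n. K * inverse ((real (Suc n))\<^sup>2))"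
      using inverse_power_summable[of 2, where ?'a = real]
      by (intro summable_mult) (subst summable_Suc_iff, simp)
    have "\<forall>\<^sub>F q in ?F. \<forall>n. norm (D n q) \<le> K * inverse ((real (Suc n))\<^sup>2)"
      using inside unfolding D_def a_def K_def
      by eventually_elim (intro allI second_difference_bound M c)
    then show "\<forall>\<^sub>F (n, q) in at_top \<times>\<^sub>F ?F. norm (D n q) \<le> K * inverse ((real (Suc n))\<^sup>2)"
      unfolding eventually_prod_filter
      by (intro exI[of _ "\<lambda>_. True"] exI[of _ "\<lambda>q. \<forall>n. norm (D n q) \<le> K * inverse ((real (Suc n))\<^sup>2)"]) auto
  qed (fact nontrivial)
  then have "((\<lambda>q. (3 - q ^ b + (\<Sum>n. D n q)) / 4) \<longlongrightarrow> (3 - 1 ^ b + (\<Sum>n. 0)) / 4) ?F"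
    by (intro tendsto_intros) auto
  moreover have "\<forall>\<^sub>F q in ?F. (3 - q ^ b + (\<Sum>n. D n q)) / 4 = partial_theta c b q"
    using inside
  proof eventually_elim
    case (elim q)
    then have "4 * partial_theta c b q = 3 - q ^ b + (\<Sum>n. D n q)"
      unfolding D_def a_def using b by (intro four_partial_theta) (simp_all add: stolz_region_def)
    then show ?case
      by (metis nonzero_mult_div_cancel_left zero_neq_numeral)
  qed
  ultimately have "(partial_theta c b \<longlongrightarrow> (3 - 1 ^ b + (\<Sum>n. 0)) / 4) ?F"
    by (rule Lim_transform_eventually)
  then show ?thesis by simp
qed

section \<open>Sums over partitions into distinct parts\<close>

definition strict_partitions_upto :: "nat \<Rightarrow> nat list set" where
  "strict_partitions_upto n = {xs \<in> partitions. distinct xs \<and> set xs \<subseteq> {..n}}"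

lemma strict_partitions_upto_0: "strict_partitions_upto 0 = {[]}"
proof -
  have "xs = []" if "xs \<in> strict_partitions_upto 0" for xs
    using that by (cases xs) (auto simp: strict_partitions_upto_def partitions_def)
  then show ?thesis
    by (auto simp: strict_partitions_upto_def partitions_def)
qed

text \<open>A strict partition with parts at most \<open>n + 1\<close> has \<open>n + 1\<close> as its first entry or does not contain it.\<close>

lemma strict_partitions_upto_Suc:
  "strict_partitions_upto (Suc n) = strict_partitions_upto n \<union> (#) (Suc n) ` strict_partitions_upto n"
proof (intro subset_antisym subsetI)
  fix xs assume xs: "xs \<in> strict_partitions_upto (Suc n)"
  show "xs \<in> strict_partitions_upto n \<union> (#) (Suc n) ` strict_partitions_upto n"
  proof (cases "Suc n \<in> set xs")
    case False
    with xs show ?thesis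
      by (fastforce simp: strict_partitions_upto_def le_Suc_eq)
  next
    case True
    with xs obtain ys where ys: "xs = Suc n # ys"
      by (cases xs) (auto simp: strict_partitions_upto_def partitions_def)
    with xs have "ys \<in> strict_partitions_upto n"
      by (fastforce simp: strict_partitions_upto_def partitions_def le_Suc_eq)
    with ys show ?thesis by simp
  qed
next
  fix xs assume "xs \<in> strict_partitions_upto n \<union> (#) (Suc n) ` strict_partitions_upto n"
  then show "xs \<in> strict_partitions_upto (Suc n)"
    by (fastforce simp: strict_partitions_upto_def partitions_def)
qed

lemma finite_strict_partitions_upto: "finite (strict_partitions_upto n)"
  by (induction n) (simp_all add: strict_partitions_upto_0 strict_partitions_upto_Suc)

lemma strict_partitions_upto_mono: "m \<le> n \<Longrightarrow> strict_partitions_upto m \<subseteq> strict_partitions_upto n"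
  by (auto simp: strict_partitions_upto_def)

lemma sum_strict_partitions_upto_Suc:
  "(\<Sum>xs\<in>strict_partitions_upto (Suc n). f xs)
   = (\<Sum>xs\<in>strict_partitions_upto n. f xs) + (\<Sum>xs\<in>strict_partitions_upto n. f (Suc n # xs))"
proof -
  have "strict_partitions_upto n \<inter> (#) (Suc n) ` strict_partitions_upto n = {}"
    by (auto simp: strict_partitions_upto_def)
  then show ?thesis
    by (simp add: strict_partitions_upto_Suc sum.union_disjoint finite_strict_partitions_upto
        sum.reindex)
qed

lemma finite_subset_strict_partitions_upto:
  assumes "finite X" "X \<subseteq> (\<Union>n. strict_partitions_upto n)"
  obtains n where "X \<subseteq> strict_partitions_upto n"
proof -
  have "\<exists>n. X \<subseteq> strict_partitions_upto n"
    using assms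
  proof (induction X)
    case (insert x X)
    then obtain m n where "X \<subseteq> strict_partitions_upto m" "x \<in> strict_partitions_upto n" by auto
    then have "insert x X \<subseteq> strict_partitions_upto (max m n)"
      using strict_partitions_upto_mono[of m "max m n"] strict_partitions_upto_mono[of n "max m n"] by auto
    then show ?case by blast
  qed simp
  with that show thesis by blast
qed

lemma sum_strict_partitions_upto_tendsto:
  fixes f :: "nat list \<Rightarrow> complex"
  assumes "f summable_on (\<Union>n. strict_partitions_upto n)"
  shows "(\<lambda>n. \<Sum>xs\<in>strict_partitions_upto n. f xs) \<longlonglongrightarrow> infsum f (\<Union>n. strict_partitions_upto n)"
proof -
  have "filterlim strict_partitions_upto (finite_subsets_at_top (\<Union>n. strict_partitions_upto n)) sequentially"
    unfolding filterlim_finite_subsets_at_top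
  proof (intro allI impI)
    fix X :: "nat list set"
    assume "finite X \<and> X \<subseteq> (\<Union>n. strict_partitions_upto n)"
    then obtain m where "X \<subseteq> strict_partitions_upto m"
      using finite_subset_strict_partitions_upto by blast
    then show "\<forall>\<^sub>F n in sequentially. finite (strict_partitions_upto n) \<and> X \<subseteq> strict_partitions_upto n \<and>
        strict_partitions_upto n \<subseteq> (\<Union>n. strict_partitions_upto n)"
      using strict_partitions_upto_mono finite_strict_partitions_upto
      by (intro eventually_sequentiallyI[of m]) blast
  qed
  with has_sum_infsum[OF assms] show ?thesis
    unfolding has_sum_def by (rule filterlim_compose)
qed

lemma sum_norm_power_strict_partitions_upto:
  "(\<Sum>xs\<in>strict_partitions_upto n. norm q ^ sum_list xs) = (\<Prod>i=1..n. 1 + norm q ^ i)"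
  by (induction n)
    (simp_all add: strict_partitions_upto_0 sum_strict_partitions_upto_Suc power_add
      sum_distrib_left[symmetric] sum_distrib_right[symmetric] algebra_simps)

text \<open>Every finite partial sum of the norms is at most some \<open>\<Prod>i=1..n. 1 + norm q ^ i\<close>, and these products are
bounded.\<close>

lemma summable_strict_partitions:
  assumes q: "norm q < 1" and f: "\<And>xs. norm (f xs :: complex) \<le> norm q ^ sum_list xs"
  shows "f summable_on (\<Union>n. strict_partitions_upto n)"
proof (rule abs_summable_summable, unfold abs_summable_iff_bdd_above, rule bdd_aboveI2)
  fix X assume "X \<in> {X. X \<subseteq> (\<Union>n. strict_partitions_upto n) \<and> finite X}"
  then obtain n where n: "X \<subseteq> strict_partitions_upto n"
    using finite_subset_strict_partitions_upto by blast
  have "(\<Sum>x\<in>X. norm (f x)) \<le> (\<Sum>xs\<in>strict_partitions_upto n. norm (f xs))"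
    using n by (intro sum_mono2 finite_strict_partitions_upto) auto
  also have "\<dots> \<le> (\<Sum>xs\<in>strict_partitions_upto n. norm q ^ sum_list xs)"
    by (intro sum_mono f)
  also have "\<dots> = norm (qpoch (-1) (complex_of_real (norm q)) n)"
  proof -
    have "qpoch (-1) (complex_of_real (norm q)) n = complex_of_real (\<Prod>i=1..n. 1 + norm q ^ i)"
      by (simp add: qpoch_def)
    then show ?thesis
      unfolding sum_norm_power_strict_partitions_upto by (simp only: norm_of_real) (simp add: prod_nonneg)
  qed
  also have "\<dots> \<le> exp (1 / (1 - norm q)^2)"
    using qpoch_bounded[of "complex_of_real (norm q)" "-1" n] q by simp
  finally show "(\<Sum>x\<in>X. norm (f x)) \<le> exp (1 / (1 - norm q)^2)" .
qed

text \<open>The restriction on the smallest part is moved from the index set of \<open>F\<close> into the summand, so that the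
index set no longer depends on \<open>S\<close> and the recursion can run over all strict partitions.\<close>

definition F_term :: "nat set \<Rightarrow> complex \<Rightarrow> nat list \<Rightarrow> complex" where
  "F_term S q xs = (if xs \<noteq> [] \<and> sm xs \<in> S
     then of_int (moebius_partition_star xs) * q ^ sum_list xs else 0)"

definition F_upto :: "nat set \<Rightarrow> complex \<Rightarrow> nat \<Rightarrow> complex" where
  "F_upto S q n = (\<Sum>xs\<in>strict_partitions_upto n. F_term S q xs)"

lemma F_upto_tendsto:
  assumes q: "norm q < 1"
  shows "F_upto S q \<longlonglongrightarrow> F S q"
proof -
  have "F S q = infsum (F_term S q) (\<Union>n. strict_partitions_upto n)"
    unfolding F_def
  proof (rule infsum_cong_neutral)
    fix xs assume xs: "xs \<in> {xs \<in> partitions. xs \<noteq> [] \<and> sm xs \<in> S} - (\<Union>n. strict_partitions_upto n)"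
    have "set xs \<subseteq> {..Max (set xs)}" by auto
    with xs have "\<not> distinct xs" by (auto simp: strict_partitions_upto_def)
    then show "of_int (moebius_partition_star xs) * q ^ sum_list xs = 0"
      by (simp add: moebius_partition_star_def moebius_partition_def)
  qed (auto simp: F_term_def strict_partitions_upto_def)
  moreover have "F_term S q summable_on (\<Union>n. strict_partitions_upto n)"
    by (rule summable_strict_partitions[OF q])
      (auto simp: F_term_def moebius_partition_star_def moebius_partition_def norm_mult norm_power)
  ultimately show ?thesis
    unfolding F_upto_def using sum_strict_partitions_upto_tendsto by metis
qed

lemma F_upto_0 [simp]: "F_upto S q 0 = 0"
  by (simp add: F_upto_def strict_partitions_upto_0 F_term_def)

text \<open>Prepending a new largest part \<open>n + 1\<close> flips the sign, multiplies by \<open>q ^ (n + 1)\<close> and keeps the smallest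
part, unless the partition is empty; the partition with the single part \<open>n + 1\<close> accounts for the last summand.\<close>

lemma F_upto_Suc:
  "F_upto S q (Suc n) = (1 - q ^ Suc n) * F_upto S q n + (if Suc n \<in> S then q ^ Suc n else 0)"
proof -
  have "F_term S q (Suc n # xs) = - (q ^ Suc n) * F_term S q xs + (if xs = [] then (if Suc n \<in> S then q ^ Suc n else 0) else 0)"
    if "xs \<in> strict_partitions_upto n" for xs
  proof -
    have "Suc n \<notin> set xs" using that by (auto simp: strict_partitions_upto_def)
    then show ?thesis
      by (auto simp: F_term_def sm_def moebius_partition_star_def moebius_partition_def power_add)
  qed
  then have "(\<Sum>xs\<in>strict_partitions_upto n. F_term S q (Suc n # xs))
      = (\<Sum>xs\<in>strict_partitions_upto n. - (q ^ Suc n) * F_term S q xs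
          + (if xs = [] then (if Suc n \<in> S then q ^ Suc n else 0) else 0))"
    by (intro sum.cong) auto
  also have "\<dots> = - (q ^ Suc n) * F_upto S q n + (if Suc n \<in> S then q ^ Suc n else 0)"
  proof -
    have "[] \<in> strict_partitions_upto n"
      by (simp add: strict_partitions_upto_def partitions_def)
    then show ?thesis
      by (simp only: sum.distrib sum_distrib_left[symmetric] F_upto_def
          sum.delta[OF finite_strict_partitions_upto] if_True)
  qed
  finally show ?thesis
    by (simp add: F_upto_def sum_strict_partitions_upto_Suc algebra_simps)
qed

section \<open>Odd and even smallest parts\<close>

text \<open>Both sides satisfy the same recursion, because \<open>x - (-1) ^ j * x\<close> is \<open>2 * x\<close> for odd \<open>j\<close> and \<open>0\<close> for even \<open>j\<close>.\<close>

lemma F_upto_S12: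
  assumes "norm q < 1"
  shows "2 * F_upto S12 q n = 1 - alternating_qpoch_sum q n"
proof (induction n)
  case (Suc n)
  have "2 * F_upto S12 q (Suc n) = (1 - q ^ Suc n) * (2 * F_upto S12 q n) + (if odd (Suc n) then 2 * q ^ Suc n else 0)"
    by (simp add: F_upto_Suc S12_def algebra_simps)
  also have "\<dots> = 1 - ((1 - q ^ Suc n) * alternating_qpoch_sum q n + (-q) ^ Suc n)"
    unfolding Suc.IH by (simp add: algebra_simps)
  finally show ?case
    by (simp only: alternating_qpoch_sum_Suc[OF assms])
qed simp

lemma F_upto_S12_S22: "F_upto S12 q n + F_upto S22 q n = 1 - qpoch 1 q n"
proof (induction n)
  case (Suc n)
  have "F_upto S12 q (Suc n) + F_upto S22 q (Suc n) = (1 - q ^ Suc n) * (F_upto S12 q n + F_upto S22 q n) + q ^ Suc n"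
    by (simp add: F_upto_Suc S12_def S22_def algebra_simps)
  also have "\<dots> = 1 - qpoch 1 q (Suc n)"
    unfolding Suc.IH by (simp add: qpoch_Suc algebra_simps)
  finally show ?case .
qed simp

lemma F_S12_eq_partial_theta:
  assumes q: "norm q < 1"
  shows "F S12 q = 1 - partial_theta 2 1 q"
proof -
  have "(\<lambda>n. 2 * F_upto S12 q n) \<longlonglongrightarrow> 2 * F S12 q"
    by (intro tendsto_intros F_upto_tendsto q)
  moreover have "(\<lambda>n. 2 * F_upto S12 q n) \<longlonglongrightarrow> 1 - (2 * partial_theta 2 1 q - 1)"
    unfolding F_upto_S12[OF q] by (intro tendsto_diff tendsto_const alternating_qpoch_sum_tendsto q)
  ultimately have "2 * F S12 q = 1 - (2 * partial_theta 2 1 q - 1)"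
    by (rule LIMSEQ_unique)
  then have "2 * F S12 q = 2 * (1 - partial_theta 2 1 q)" by simp
  then show ?thesis by (simp only: mult_cancel_left) simp
qed

lemma F_S22_eq_partial_theta:
  assumes q: "norm q < 1"
  shows "F S22 q = 1 + partial_theta 2 1 q - partial_theta 3 1 q - partial_theta 3 2 q"
proof -
  have "(\<lambda>n. F_upto S12 q n + F_upto S22 q n) \<longlonglongrightarrow> F S12 q + F S22 q"
    by (intro tendsto_intros F_upto_tendsto q)
  moreover have "(\<lambda>n. F_upto S12 q n + F_upto S22 q n)
      \<longlonglongrightarrow> 1 - (partial_theta 3 1 q + partial_theta 3 2 q - 1)"
    unfolding F_upto_S12_S22 by (intro tendsto_diff tendsto_const qpoch_tendsto_pentagonal q)
  ultimately have "F S12 q + F S22 q = 1 - (partial_theta 3 1 q + partial_theta 3 2 q - 1)"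
    by (rule LIMSEQ_unique)
  then show ?thesis
    unfolding F_S12_eq_partial_theta[OF q] by (simp add: algebra_simps)
qed

lemma square_series_has_sum:
  assumes q: "norm q < 1"
  shows "((\<lambda>n. (-1) ^ n * q ^ n\<^sup>2) has_sum (partial_theta 2 1 q - 1)) {1..}"
  using partial_theta_has_sum_pos[OF q, of 1 2] by (simp add: double_choose_two)

text \<open>The indices \<open>m \<ge> 0\<close> and \<open>m < 0\<close> give the two one-sided series, as
\<open>n * (3 * n \<mp> 1) / 2 = 3 * (n choose 2) + n\<close> or \<open>3 * (n choose 2) + 2 * n\<close> respectively; the second one starts at \<open>n = 1\<close>.\<close>

lemma pentagonal_series_has_sum:
  assumes q: "norm q < 1"
  shows "((\<lambda>m. (-1) powi m * q powi (m * (3 * m - 1) div 2))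
      has_sum (partial_theta 3 1 q + (partial_theta 3 2 q - 1))) (UNIV :: int set)"
proof -
  let ?f = "\<lambda>m :: int. (-1) powi m * q powi (m * (3 * m - 1) div 2)"
  have sq: "int n * int n = 2 * int (n choose 2) + int n" for n
    using double_choose_two[of n] by (metis of_nat_add of_nat_mult of_nat_numeral power2_eq_square)
  have pos: "?f (int n) = (-1) ^ n * q ^ (3 * (n choose 2) + 1 * n)" for n
  proof -
    have "int n * (3 * int n - 1) div 2 = int (3 * (n choose 2) + 1 * n)"
      using sq[of n] by (simp add: algebra_simps)
    then show ?thesis by (simp only: power_int_of_nat)
  qed
  have neg: "?f (- int n) = (-1) ^ n * q ^ (3 * (n choose 2) + 2 * n)" for n
  proof -
    have "- int n * (3 * (- int n) - 1) div 2 = int (3 * (n choose 2) + 2 * n)"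
      using sq[of n] by (simp add: algebra_simps)
    then show ?thesis by (simp only: power_int_of_nat) (simp add: power_int_minus power_inverse[symmetric])
  qed
  have "(?f has_sum partial_theta 3 1 q) (int ` UNIV)"
    by (subst has_sum_reindex) (use partial_theta_has_sum[OF q, of 1 3] in \<open>simp_all only: pos o_def inj_of_nat\<close>)
  moreover have "(?f has_sum (partial_theta 3 2 q - 1)) ((\<lambda>n. - int n) ` {1..})"
    by (subst has_sum_reindex)
      (use partial_theta_has_sum_pos[OF q, of 2 3] in \<open>simp_all only: neg o_def inj_on_def, auto\<close>)
  moreover have "int ` UNIV \<inter> (\<lambda>n. - int n) ` {1..} = {}" by auto
  moreover have "int ` UNIV \<union> (\<lambda>n. - int n) ` {1..} = UNIV"
  proof (intro subset_antisym subset_UNIV subsetI)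
    fix m :: int
    show "m \<in> int ` UNIV \<union> (\<lambda>n. - int n) ` {1..}"
      by (cases m rule: int_cases2) (auto simp: image_iff Suc_le_eq)
  qed
  ultimately show ?thesis
    using has_sum_Un_disjoint by metis
qed

theorem theorem1p1:
  shows "(\<forall>q. norm q < 1 \<longrightarrow>
      F S12 q = (\<Sum>\<^sub>\<infinity>n\<in>{1..}. (-1) ^ (n + 1) * q ^ (n\<^sup>2)) \<and>
      F S22 q = 1 + (\<Sum>\<^sub>\<infinity>n\<in>{1..}. (-1) ^ n * q ^ (n\<^sup>2))
        - (\<Sum>\<^sub>\<infinity>m\<in>(UNIV :: int set). (-1) powi m * q powi (m * (3 * m - 1) div 2))) \<and>
    (\<forall>M. (F S12 \<longlongrightarrow> 1 / 2) (at 1 within stolz_region M) \<and>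
         (F S22 \<longlongrightarrow> 1 / 2) (at 1 within stolz_region M))"
proof (intro conjI allI impI)
  fix q :: complex
  assume q: "norm q < 1"
  note squares = square_series_has_sum[OF q] and pentagonal = pentagonal_series_has_sum[OF q]
  have "((\<lambda>n. - ((-1) ^ n * q ^ n\<^sup>2)) has_sum - (partial_theta 2 1 q - 1)) {1..}"
    using squares by (simp add: has_sum_uminus)
  then show "F S12 q = (\<Sum>\<^sub>\<infinity>n\<in>{1..}. (-1) ^ (n + 1) * q ^ (n\<^sup>2))"
    by (simp add: F_S12_eq_partial_theta[OF q] infsumI)
  show "F S22 q = 1 + (\<Sum>\<^sub>\<infinity>n\<in>{1..}. (-1) ^ n * q ^ (n\<^sup>2))
        - (\<Sum>\<^sub>\<infinity>m\<in>(UNIV :: int set). (-1) powi m * q powi (m * (3 * m - 1) div 2))"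
    unfolding infsumI[OF squares] infsumI[OF pentagonal] F_S22_eq_partial_theta[OF q] by simp
next
  fix M
  let ?F = "at (1 :: complex) within stolz_region M"
  have inside: "\<forall>\<^sub>F q in ?F. norm q < 1"
    by (auto simp: eventually_at_filter stolz_region_def)
  have "((\<lambda>q. 1 - partial_theta 2 1 q) \<longlongrightarrow> 1 - 1 / 2) ?F"
    by (intro tendsto_diff tendsto_const partial_theta_tendsto_half) auto
  moreover have "\<forall>\<^sub>F q in ?F. 1 - partial_theta 2 1 q = F S12 q"
    using inside by eventually_elim (simp add: F_S12_eq_partial_theta)
  ultimately have "(F S12 \<longlongrightarrow> 1 - 1 / 2) ?F"
    by (rule Lim_transform_eventually)
  then show "(F S12 \<longlongrightarrow> 1 / 2) ?F" by simp
  have "((\<lambda>q. 1 + partial_theta 2 1 q - partial_theta 3 1 q - partial_theta 3 2 q)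
      \<longlongrightarrow> 1 + 1 / 2 - 1 / 2 - 1 / 2) ?F"
    by (intro tendsto_diff tendsto_add tendsto_const partial_theta_tendsto_half) auto
  moreover have "\<forall>\<^sub>F q in ?F. 1 + partial_theta 2 1 q - partial_theta 3 1 q - partial_theta 3 2 q = F S22 q"
    using inside by eventually_elim (simp add: F_S22_eq_partial_theta)
  ultimately have "(F S22 \<longlongrightarrow> 1 + 1 / 2 - 1 / 2 - 1 / 2) ?F"
    by (rule Lim_transform_eventually)
  then show "(F S22 \<longlongrightarrow> 1 / 2) ?F" by simp
qed

end
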